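(* Surjunctive groups satisfy Kaplansky's stable finiteness conjecture; that is, if $\Gamma$ is a surjunctive group, then for every field $\mathbb{F}$ the group ring $\mathbb{F}[\Gamma]$ is stably finite.
   Context: Let $\Gamma$ be a group and $F$ a finite set (the alphabet). Let $F^\Gamma=\prod_{\gamma\in\Gamma}F$ carry the prodiscrete topology (product of the discrete topologies) and the usual left shift action of $\Gamma$, $(\gamma x)(g) = x(\gamma^{-1}g)$. A cellular automaton over $\Gamma$ with alphabet $F$ is a continuous $\Gamma$-equivariant map $F^\Gamma\to F^\Gamma$. $\Gamma$ is surjunctive if, for every finite set $F$, every injective cellular automaton $F^\Gamma\to F^\Gamma$ is surjective. A ring $R$ with identity is directly finite if for all $x,y\in R$, $xy=1$ implies $yx=1$; it is stably finite if $\mathbb{M}_d(R)$ is directly finite for every $d\ge1$. *)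

theory Defs
  imports
    "HOL-Analysis.Function_Topology"
    "HOL-Library.Poly_Mapping"
    "Jordan_Normal_Form.Matrix"
begin

text \<open>
  Groups are types of class \<open>group_add\<close>: additive notation, but no commutativity is assumed.
  The group ring of \<open>'g\<close> over \<open>'k\<close> is the type of finitely supported functions
  \<open>'g \<Rightarrow>\<^sub>0 'k\<close>, whose product is the convolution
  \<open>(a * b)(g) = (\<Sum>h + h' = g. a(h) b(h'))\<close>.
\<close>

definition full_shift :: "'a set \<Rightarrow> ('g \<Rightarrow> 'a) topology" where
  "full_shift F = product_topology (\<lambda>_. discrete_topology F) UNIV"

definition shift :: "'g::group_add \<Rightarrow> ('g \<Rightarrow> 'a) \<Rightarrow> 'g \<Rightarrow> 'a" where
  "shift \<gamma> x = (\<lambda>g. x (- \<gamma> + g))"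

text \<open>The values of \<open>\<tau>\<close> outside the full shift over \<open>F\<close> are irrelevant.\<close>

definition cellular_automaton :: "'a set \<Rightarrow> (('g::group_add \<Rightarrow> 'a) \<Rightarrow> 'g \<Rightarrow> 'a) \<Rightarrow> bool" where
  "cellular_automaton F \<tau> \<longleftrightarrow>
     continuous_map (full_shift F) (full_shift F) \<tau> \<and>
     (\<forall>\<gamma>. \<forall>x \<in> topspace (full_shift F). \<tau> (shift \<gamma> x) = shift \<gamma> (\<tau> x))"

text \<open>
  A definition cannot quantify over types, so the alphabets are the finite sets of natural numbers;
  every finite set is in bijection with one of them. Lemma \<open>surjunctive_alphabet\<close> below
  gives the property for finite alphabets of any type.
\<close>

definition surjunctive :: "'g::group_add itself \<Rightarrow> bool" where
  "surjunctive _ \<longleftrightarrow>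
     (\<forall>(F :: nat set) (\<tau> :: ('g \<Rightarrow> nat) \<Rightarrow> 'g \<Rightarrow> nat).
        finite F \<longrightarrow> cellular_automaton F \<tau> \<longrightarrow> inj_on \<tau> (topspace (full_shift F)) \<longrightarrow>
        \<tau> ` topspace (full_shift F) = topspace (full_shift F))"

definition directly_finite :: "('r, 'm) ring_scheme \<Rightarrow> bool" where
  "directly_finite R \<longleftrightarrow>
     (\<forall>x \<in> carrier R. \<forall>y \<in> carrier R.
        x \<otimes>\<^bsub>R\<^esub> y = \<one>\<^bsub>R\<^esub> \<longrightarrow> y \<otimes>\<^bsub>R\<^esub> x = \<one>\<^bsub>R\<^esub>)"

definition stably_finite :: "'r::ring_1 itself \<Rightarrow> bool" where
  "stably_finite _ \<longleftrightarrow> (\<forall>d\<ge>1. directly_finite (ring_mat TYPE('r) d ()))"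

lemma topspace_full_shift: "x \<in> topspace (full_shift F) \<longleftrightarrow> (\<forall>g. x g \<in> F)"
  by (auto simp: full_shift_def PiE_iff)

lemma continuous_map_full_shift_comp:
  fixes F :: "'a set" and G :: "'b set"
  assumes "\<And>a. a \<in> F \<Longrightarrow> h a \<in> G"
  shows "continuous_map (full_shift F) (full_shift G) (\<lambda>(x :: 'g \<Rightarrow> 'a) g. h (x g))"
proof -
  have "continuous_map (full_shift F) (discrete_topology G) (h \<circ> (\<lambda>x. x g))" for g :: 'g
  proof (rule continuous_map_compose)
    show "continuous_map (full_shift F) (discrete_topology F) (\<lambda>x. x g)"
      unfolding full_shift_def by (rule continuous_map_product_projection) simp
    show "continuous_map (discrete_topology F) (discrete_topology G) h"
      using assms by auto
  qed
  then show ?thesis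
    by (simp add: full_shift_def continuous_map_componentwise_UNIV o_def)
qed

lemma surjunctive_alphabet:
  fixes F :: "'a set" and \<tau> :: "('g::group_add \<Rightarrow> 'a) \<Rightarrow> 'g \<Rightarrow> 'a"
  assumes "surjunctive TYPE('g)" "finite F" "cellular_automaton F \<tau>"
    and inj: "inj_on \<tau> (topspace (full_shift F))"
  shows "\<tau> ` topspace (full_shift F) = topspace (full_shift F)"
proof -
  obtain h :: "'a \<Rightarrow> nat" where h: "inj_on h F"
    using finite_imp_inj_to_nat_seg[OF \<open>finite F\<close>] by blast
  define G where "G = h ` F"
  define k where "k = inv_into F h"
  have hF: "h a \<in> G" and kh: "k (h a) = a" if "a \<in> F" for a
    using that by (simp_all add: G_def k_def inv_into_f_f[OF h])
  have kG: "k b \<in> F" and hk: "h (k b) = b" if "b \<in> G" for b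
    using that by (simp_all add: G_def k_def inv_into_into f_inv_into_f)
  define H where "H = (\<lambda>(x :: 'g \<Rightarrow> 'a) g. h (x g))"
  define K where "K = (\<lambda>(y :: 'g \<Rightarrow> nat) g. k (y g))"
  let ?X = "topspace (full_shift F) :: ('g \<Rightarrow> 'a) set"
  let ?Y = "topspace (full_shift G) :: ('g \<Rightarrow> nat) set"
  have H: "H x \<in> ?Y" "K (H x) = x" if "x \<in> ?X" for x
    using that by (simp_all add: H_def K_def topspace_full_shift hF kh)
  have K: "K y \<in> ?X" "H (K y) = y" if "y \<in> ?Y" for y
    using that by (simp_all add: H_def K_def topspace_full_shift kG hk)
  have contH: "continuous_map (full_shift F) (full_shift G) H"
    unfolding H_def using hF by (rule continuous_map_full_shift_comp)
  have contK: "continuous_map (full_shift G) (full_shift F) K"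
    unfolding K_def using kG by (rule continuous_map_full_shift_comp)
  have cont: "continuous_map (full_shift F) (full_shift F) \<tau>"
    and eq: "\<And>\<gamma> x. x \<in> ?X \<Longrightarrow> \<tau> (shift \<gamma> x) = shift \<gamma> (\<tau> x)"
    using assms(3) unfolding cellular_automaton_def by blast+
  have tX: "\<tau> x \<in> ?X" if "x \<in> ?X" for x
    using continuous_map_image_subset_topspace[OF cont] that by blast
  define \<sigma> where "\<sigma> = H \<circ> (\<tau> \<circ> K)"
  have "cellular_automaton G \<sigma>"
    unfolding cellular_automaton_def
  proof (intro conjI allI ballI)
    show "continuous_map (full_shift G) (full_shift G) \<sigma>"
      unfolding \<sigma>_def by (intro continuous_map_compose[OF _ contH] continuous_map_compose[OF contK cont])
    fix \<gamma> y assume y: "y \<in> ?Y"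
    have "K (shift \<gamma> y) = shift \<gamma> (K y)" by (simp add: K_def shift_def)
    then show "\<sigma> (shift \<gamma> y) = shift \<gamma> (\<sigma> y)"
      using eq[OF K(1)[OF y]] by (simp add: \<sigma>_def H_def shift_def)
  qed
  moreover have "inj_on \<sigma> ?Y"
  proof (rule inj_onI)
    fix y y' assume y: "y \<in> ?Y" "y' \<in> ?Y" and "\<sigma> y = \<sigma> y'"
    then have "K (H (\<tau> (K y))) = K (H (\<tau> (K y')))" by (simp add: \<sigma>_def)
    then have "\<tau> (K y) = \<tau> (K y')" by (simp only: H(2) tX K(1) y)
    then have "K y = K y'" using inj K(1) y by (auto dest: inj_onD)
    then have "H (K y) = H (K y')" by (rule arg_cong)
    then show "y = y'" by (simp only: K(2) y)
  qed
  moreover have "finite G" using \<open>finite F\<close> by (simp add: G_def)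
  ultimately have surj: "\<sigma> ` ?Y = ?Y"
    using assms(1) unfolding surjunctive_def by blast
  have "x \<in> \<tau> ` ?X" if x: "x \<in> ?X" for x
  proof -
    have "H x \<in> \<sigma> ` ?Y" unfolding surj by (rule H(1)[OF x])
    then obtain y where y: "y \<in> ?Y" "\<sigma> y = H x" by (metis imageE)
    then have "K (H (\<tau> (K y))) = K (H x)" by (simp add: \<sigma>_def)
    then have "\<tau> (K y) = x" by (simp only: H(2) tX K(1) x y(1))
    then show ?thesis using K(1)[OF y(1)] by (metis imageI)
  qed
  then show ?thesis using tX by (intro subset_antisym subsetI) auto
qed

end

theory Submission
  imports Defs "HOL-Computational_Algebra.Primes" "HOL-Computational_Algebra.Polynomial"
begin

text \<open>
  Over a finite alphabet, stable finiteness is the definition of surjunctivity read twice. A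
  \<open>d \<times> d\<close> matrix over the group ring acts on configurations \<open>\<Gamma> \<rightarrow> K\<^sup>d\<close> by a local rule
  commuting with the shift. If \<open>X Y = 1\<close>, the action of \<open>Y\<close> is injective. Were \<open>K\<close> finite, it would
  be a cellular automaton, hence surjective, hence inverse to that of \<open>X\<close> on both sides; evaluating
  at configurations supported at one point gives \<open>Y X = 1\<close>.

  An arbitrary field is reduced to finite alphabets by arithmetic. Suppose \<open>Y X \<noteq> 1\<close>, and let \<open>c\<close> be
  a nonzero coefficient of \<open>Y X - 1\<close>. Only finitely many elements of \<open>K\<close> are involved, and they lie
  in a subring \<open>A\<close> generated by finitely many elements. Such an \<open>A\<close> has a prime ideal \<open>P\<close> of finite
  index with \<open>c \<notin> P\<close> (\<open>separated_subring_containing\<close>). The first argument applies to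
  \<open>(A / P)\<^sup>d\<close> and yields \<open>Y X = 1\<close> modulo \<open>P\<close> (\<open>surjunctive_left_inverse_mod_ideal\<close>), so
  \<open>c \<in> P\<close>, a contradiction.

  That finitely generated subrings have enough finite quotients is an elementary form of the
  Nullstellensatz over the integers, obtained by adjoining one generator \<open>b\<close> at a time. Choose
  \<open>m \<in> A[x]\<close> of positive degree whose leading coefficient avoids a prime \<open>I\<close> of finite index. Then
  \<open>J = I[x] + m A[x]\<close> has finite index in \<open>A[x]\<close>, because the leading coefficient of \<open>m\<close> is
  invertible modulo \<open>I\<close>, and \<open>J \<inter> A = I\<close>, by comparing leading coefficients modulo \<open>I\<close>. For
  algebraic \<open>b\<close> take for \<open>m\<close> an annihilating polynomial of minimal degree. For transcendental \<open>b\<close>,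
  where \<open>c = p(b)\<close> must survive, take \<open>m = 1 - x p\<close>, which makes \<open>c\<close> a unit. In both cases the image
  of \<open>J\<close> in \<open>A[b]\<close> contains no power of \<open>c\<close>, and can be enlarged to a prime without \<open>c\<close>.
\<close>

section \<open>Subrings and ideals of finite index\<close>

text \<open>
  The subrings of interest vary inside one fixed field, so rings are subsets closed under the operations
  of a type class. The same predicates then serve for \<open>A\<close> and for the polynomials with
  coefficients in \<open>A\<close>.
\<close>

definition unital_subring :: "'a::comm_ring_1 set \<Rightarrow> bool" where
  "unital_subring A \<longleftrightarrow> 1 \<in> A \<and> (\<forall>x\<in>A. \<forall>y\<in>A. x - y \<in> A \<and> x * y \<in> A)"

definition ideal_of :: "'a::comm_ring_1 set \<Rightarrow> 'a set \<Rightarrow> bool" where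
  "ideal_of A I \<longleftrightarrow> I \<subseteq> A \<and> 0 \<in> I \<and> (\<forall>x\<in>I. \<forall>y\<in>I. x + y \<in> I) \<and> (\<forall>a\<in>A. \<forall>x\<in>I. a * x \<in> I)"

text \<open>
  A finite set \<open>T\<close> meeting every coset is easier to transport along quotients and ring
  homomorphisms than the finiteness of a set of cosets. Several elements of \<open>T\<close> may represent the
  same coset.
\<close>

definition finite_index :: "'a::comm_ring_1 set \<Rightarrow> 'a set \<Rightarrow> bool" where
  "finite_index A I \<longleftrightarrow> (\<exists>T. finite T \<and> T \<subseteq> A \<and> (\<forall>x\<in>A. \<exists>t\<in>T. x - t \<in> I))"

definition prime_ideal_of :: "'a::comm_ring_1 set \<Rightarrow> 'a set \<Rightarrow> bool" where
  "prime_ideal_of A P \<longleftrightarrow>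
     ideal_of A P \<and> 1 \<notin> P \<and> (\<forall>x\<in>A. \<forall>y\<in>A. x * y \<in> P \<longrightarrow> x \<in> P \<or> y \<in> P)"

definition separated_by_finite_primes :: "'a::comm_ring_1 set \<Rightarrow> bool" where
  "separated_by_finite_primes A \<longleftrightarrow>
     (\<forall>c\<in>A. c \<noteq> 0 \<longrightarrow> (\<exists>P. prime_ideal_of A P \<and> finite_index A P \<and> c \<notin> P))"

lemma unital_subringD:
  assumes "unital_subring A"
  shows "1 \<in> A" "0 \<in> A"
    "\<And>x y. x \<in> A \<Longrightarrow> y \<in> A \<Longrightarrow> x - y \<in> A"
    "\<And>x. x \<in> A \<Longrightarrow> - x \<in> A"
    "\<And>x y. x \<in> A \<Longrightarrow> y \<in> A \<Longrightarrow> x + y \<in> A"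
    "\<And>x y. x \<in> A \<Longrightarrow> y \<in> A \<Longrightarrow> x * y \<in> A"
    "\<And>x n. x \<in> A \<Longrightarrow> x ^ n \<in> A"
proof -
  show 1: "1 \<in> A" and d: "\<And>x y. x \<in> A \<Longrightarrow> y \<in> A \<Longrightarrow> x - y \<in> A"
    and m: "\<And>x y. x \<in> A \<Longrightarrow> y \<in> A \<Longrightarrow> x * y \<in> A"
    using assms by (auto simp: unital_subring_def)
  show 0: "0 \<in> A" using d[OF 1 1] by simp
  show n: "- x \<in> A" if "x \<in> A" for x using d[OF 0 that] by simp
  show "x + y \<in> A" if "x \<in> A" "y \<in> A" for x y using d[OF that(1) n[OF that(2)]] by simp
  show "x ^ n \<in> A" if "x \<in> A" for x n using that by (induction n) (auto simp: 1 m)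
qed

lemma unital_subring_sum:
  assumes "unital_subring A" "\<And>i. i \<in> S \<Longrightarrow> f i \<in> A"
  shows "sum f S \<in> A"
  using assms(2) by (induction S rule: infinite_finite_induct) (auto simp: unital_subringD[OF assms(1)])

lemma ideal_ofD:
  assumes "unital_subring A" "ideal_of A I"
  shows "0 \<in> I" "\<And>x. x \<in> I \<Longrightarrow> x \<in> A"
    "\<And>x y. x \<in> I \<Longrightarrow> y \<in> I \<Longrightarrow> x + y \<in> I"
    "\<And>a x. a \<in> A \<Longrightarrow> x \<in> I \<Longrightarrow> a * x \<in> I"
    "\<And>a x. a \<in> A \<Longrightarrow> x \<in> I \<Longrightarrow> x * a \<in> I"
    "\<And>x. x \<in> I \<Longrightarrow> - x \<in> I"
    "\<And>x y. x \<in> I \<Longrightarrow> y \<in> I \<Longrightarrow> x - y \<in> I"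
proof -
  show "0 \<in> I" "\<And>x. x \<in> I \<Longrightarrow> x \<in> A"
    and a: "\<And>x y. x \<in> I \<Longrightarrow> y \<in> I \<Longrightarrow> x + y \<in> I"
    and m: "\<And>a x. a \<in> A \<Longrightarrow> x \<in> I \<Longrightarrow> a * x \<in> I"
    using assms(2) by (auto simp: ideal_of_def)
  show "x * a \<in> I" if "a \<in> A" "x \<in> I" for a x using m[OF that] by (simp add: mult.commute)
  show n: "- x \<in> I" if "x \<in> I" for x
    using m[of "- 1" x] that unital_subringD[OF assms(1)] by auto
  show "x - y \<in> I" if "x \<in> I" "y \<in> I" for x y using a[OF that(1) n[OF that(2)]] by simp
qed

lemma ideal_of_sum:
  assumes "unital_subring A" "ideal_of A I" "\<And>i. i \<in> S \<Longrightarrow> f i \<in> I"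
  shows "sum f S \<in> I"
  using assms(3) by (induction S rule: infinite_finite_induct) (auto simp: ideal_ofD[OF assms(1,2)])

lemma prime_idealD:
  assumes "prime_ideal_of A P" "x \<in> A" "y \<in> A" "x * y \<in> P"
  shows "x \<in> P \<or> y \<in> P"
  using assms by (auto simp: prime_ideal_of_def)

lemma prime_ideal_power:
  assumes "unital_subring A" "prime_ideal_of A P" "x \<in> A" "x ^ n \<in> P"
  shows "x \<in> P"
  using assms(4)
proof (induction n)
  case 0
  then show ?case using assms(2) by (simp add: prime_ideal_of_def)
next
  case (Suc n)
  then show ?case
    using prime_idealD[OF assms(2,3) unital_subringD(7)[OF assms(1,3)]] by auto
qed

lemma ideal_extend:
  assumes A: "unital_subring A" and N: "ideal_of A N" and x: "x \<in> A"
  shows "ideal_of A {n + a * x | n a. n \<in> N \<and> a \<in> A}" (is "ideal_of A ?M")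
    and "N \<subseteq> {n + a * x | n a. n \<in> N \<and> a \<in> A}"
    and "x \<in> {n + a * x | n a. n \<in> N \<and> a \<in> A}"
proof -
  note a = unital_subringD[OF A] and i = ideal_ofD[OF A N]
  show sub: "N \<subseteq> ?M" using a(2) by (force)
  show "x \<in> ?M" using a(1) i(1) by force
  show "ideal_of A ?M"
    unfolding ideal_of_def
  proof (intro conjI ballI)
    show "?M \<subseteq> A" using a i x by auto
    show "0 \<in> ?M" using sub i(1) by (rule subsetD)
  next
    fix u v assume "u \<in> ?M" "v \<in> ?M"
    then obtain n b n' b' where "u = n + b * x" "v = n' + b' * x" "n \<in> N" "b \<in> A" "n' \<in> N" "b' \<in> A"
      by auto
    then have "u + v = (n + n') + (b + b') * x" "n + n' \<in> N" "b + b' \<in> A"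
      using a i by (auto simp: algebra_simps)
    then show "u + v \<in> ?M" by blast
  next
    fix b u assume b: "b \<in> A" and "u \<in> ?M"
    then obtain n b' where "u = n + b' * x" "n \<in> N" "b' \<in> A" by auto
    then have "b * u = b * n + (b * b') * x" "b * n \<in> N" "b * b' \<in> A"
      using a i b by (auto simp: algebra_simps)
    then show "b * u \<in> ?M" by blast
  qed
qed

text \<open>
  Krull's construction of prime ideals, without Zorn's lemma: among the ideals that have finite index
  and contain no power of \<open>c\<close>, one with the fewest coset representatives is maximal. If \<open>x y\<close> lay
  in it but neither factor did, then adjoining \<open>x\<close>, and likewise \<open>y\<close>, would catch a power
  of \<open>c\<close>, and the product of the two powers would be in the ideal.
\<close>

lemma finite_index_prime_avoiding:
  assumes A: "unital_subring A" and N: "ideal_of A N" and fin: "finite_index A N"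
    and c: "c \<in> A" and avoid: "\<And>k. c ^ k \<notin> N"
  shows "\<exists>P. prime_ideal_of A P \<and> finite_index A P \<and> c \<notin> P"
proof -
  note a = unital_subringD[OF A]
  define good where "good = (\<lambda>n N T. ideal_of A N \<and> (\<forall>k. c ^ k \<notin> N) \<and> finite T \<and> T \<subseteq> A \<and>
     (\<forall>x\<in>A. \<exists>t\<in>T. x - t \<in> N) \<and> card T = n)"
  have "\<exists>n N T. good n N T"
    using N fin avoid unfolding good_def finite_index_def by blast
  then obtain n0 where "\<exists>N T. good n0 N T" and least: "\<And>n. n < n0 \<Longrightarrow> \<not> (\<exists>N T. good n N T)"
    using exists_least_iff[of "\<lambda>n. \<exists>N T. good n N T"] by blast
  then obtain P T where P: "good n0 P T" by blast
  then have "n0 = card T" by (simp add: good_def)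
  then have min: "\<not> (\<exists>N T'. good n N T')" if "n < card T" for n
    using least that by blast
  from P have idl: "ideal_of A P" and av: "\<And>k. c ^ k \<notin> P" and T: "finite T" "T \<subseteq> A"
    and cover: "\<And>x. x \<in> A \<Longrightarrow> \<exists>t\<in>T. x - t \<in> P"
    unfolding good_def by auto
  note i = ideal_ofD[OF A idl]
  have larger: "\<exists>k. c ^ k \<in> Q" if Q: "ideal_of A Q" "P \<subseteq> Q" and x: "x \<in> Q" "x \<notin> P" for x Q
  proof (rule ccontr)
    assume no: "\<nexists>k. c ^ k \<in> Q"
    note q = ideal_ofD[OF A Q(1)]
    \<comment> \<open>Modulo \<open>Q\<close> the representative of \<open>x\<close> becomes superfluous, as that of \<open>0\<close> replaces it.\<close>
    obtain t where t: "t \<in> T" "x - t \<in> P" using cover q(2)[OF x(1)] by blast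
    obtain t0 where t0: "t0 \<in> T" "0 - t0 \<in> P" using cover a(2) by blast
    have t0P: "t0 \<in> P" using i(6)[OF t0(2)] by simp
    have "t \<noteq> t0" using t t0P i(3)[of "x - t" t] x(2) by auto
    have tQ: "t \<in> Q" using q(7)[OF x(1), of "x - t"] t(2) Q(2) by auto
    have "good (card (T - {t})) Q (T - {t})"
      unfolding good_def
    proof (intro conjI ballI allI)
      fix y assume "y \<in> A"
      then obtain s where s: "s \<in> T" "y - s \<in> P" using cover by blast
      show "\<exists>s\<in>T - {t}. y - s \<in> Q"
      proof (cases "s = t")
        case True
        then have "y \<in> Q" using q(3)[of "y - s" t] s tQ Q(2) by auto
        then have "y - t0 \<in> Q" using q(7) t0P Q(2) by auto
        then show ?thesis using \<open>t \<noteq> t0\<close> t0(1) by blast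
      qed (use s Q(2) in auto)
    qed (use no Q T in auto)
    moreover have "card (T - {t}) < card T" using T(1) t(1) by (meson card_Diff1_less)
    ultimately show False using min by blast
  qed
  have "prime_ideal_of A P"
    unfolding prime_ideal_of_def
  proof (intro conjI ballI impI)
    show "ideal_of A P" by (rule idl)
    show "1 \<notin> P" using av[of 0] by simp
    fix x y assume xy: "x \<in> A" "y \<in> A" "x * y \<in> P"
    show "x \<in> P \<or> y \<in> P"
    proof (rule ccontr)
      assume "\<not> (x \<in> P \<or> y \<in> P)"
      then obtain k l where "c ^ k \<in> {n + a * x | n a. n \<in> P \<and> a \<in> A}"
        and "c ^ l \<in> {n + a * y | n a. n \<in> P \<and> a \<in> A}"
        using larger[OF ideal_extend(1,2,3)[OF A idl xy(1)]]
          larger[OF ideal_extend(1,2,3)[OF A idl xy(2)]] by blast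
      then obtain n u n' v where k: "c ^ k = n + u * x" "c ^ l = n' + v * y"
        and "n \<in> P" "u \<in> A" "n' \<in> P" "v \<in> A" by auto
      have "c ^ (k + l) = n * (c ^ l) + ((u * x) * n' + (u * v) * (x * y))"
        by (simp add: power_add k algebra_simps)
      also have "\<dots> \<in> P"
        by (intro i(3)[OF i(5) i(3)[OF i(4) i(4)]] a(6) a(7) c xy
            \<open>n \<in> P\<close> \<open>u \<in> A\<close> \<open>n' \<in> P\<close> \<open>v \<in> A\<close>)
      finally show False using av by blast
    qed
  qed
  moreover have "finite_index A P" using T cover unfolding finite_index_def by blast
  moreover have "c \<notin> P" using av[of 1] by simp
  ultimately show ?thesis by blast
qed

text \<open>
  A finite integral domain is a field: two powers of \<open>a\<close> agree modulo \<open>P\<close>, and cancelling the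
  smaller one leaves a power of \<open>a\<close> congruent to \<open>1\<close>.
\<close>

lemma unit_mod_finite_prime:
  assumes A: "unital_subring A" and P: "prime_ideal_of A P" and fin: "finite_index A P"
    and a: "a \<in> A" "a \<notin> P"
  shows "\<exists>u\<in>A. 1 - u * a \<in> P"
proof -
  note s = unital_subringD[OF A]
  have idl: "ideal_of A P" using P by (simp add: prime_ideal_of_def)
  note i = ideal_ofD[OF A idl]
  obtain T where T: "finite T" "\<And>x. x \<in> A \<Longrightarrow> \<exists>t\<in>T. x - t \<in> P"
    using fin unfolding finite_index_def by blast
  have "\<forall>k::nat. \<exists>t\<in>T. a ^ k - t \<in> P" using T(2) s(7)[OF a(1)] by blast
  then obtain \<rho> where \<rho>: "\<And>k::nat. \<rho> k \<in> T" "\<And>k. a ^ k - \<rho> k \<in> P" by metis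
  have "\<not> inj \<rho>"
    using \<rho>(1) T(1) by (metis finite_imageD finite_subset image_subsetI infinite_UNIV_nat)
  then obtain k l where kl: "k < l" "\<rho> k = \<rho> l" by (metis injI linorder_neqE_nat)
  then obtain d where d: "l = k + Suc d" using less_imp_Suc_add by fastforce
  have "(a ^ k - \<rho> k) - (a ^ l - \<rho> l) \<in> P" using \<rho> i(7) by blast
  then have "a ^ k * (1 - a ^ d * a) \<in> P" using kl d by (simp add: algebra_simps power_add)
  moreover have "a ^ k \<notin> P" using prime_ideal_power[OF A P a(1)] a(2) by blast
  ultimately have "1 - a ^ d * a \<in> P"
    using prime_idealD[OF P s(7)[OF a(1)] s(3)[OF s(1) s(6)[OF s(7)[OF a(1)] a(1)]]] by blast
  then show ?thesis using s(7)[OF a(1)] by blast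
qed

section \<open>Polynomials over a subring\<close>

definition polys_over :: "'a::zero set \<Rightarrow> 'a poly set" where
  "polys_over A = {f. \<forall>i. coeff f i \<in> A}"

lemma polys_overD: "f \<in> polys_over A \<Longrightarrow> coeff f i \<in> A"
  by (simp add: polys_over_def)

lemma polys_over_mult_ideal:
  assumes A: "unital_subring A" and I: "ideal_of A I" and "f \<in> polys_over A" "g \<in> polys_over I"
  shows "f * g \<in> polys_over I"
  using assms(3,4) unfolding polys_over_def
  by (auto simp: coeff_mult intro!: ideal_of_sum[OF A I] ideal_ofD(4)[OF A I])

lemma unital_subring_polys_over:
  assumes A: "unital_subring A" shows "unital_subring (polys_over A)"
proof -
  have "ideal_of A A" using unital_subringD[OF A] by (auto simp: ideal_of_def)
  then have "x * y \<in> polys_over A" if "x \<in> polys_over A" "y \<in> polys_over A" for x y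
    using polys_over_mult_ideal[OF A] that by blast
  then show ?thesis
    using unital_subringD[OF A] unfolding unital_subring_def
    by (auto simp: polys_over_def)
qed

lemma pCons_polys_over:
  "pCons a f \<in> polys_over A \<longleftrightarrow> a \<in> A \<and> f \<in> polys_over A"
  unfolding polys_over_def by (force simp: coeff_pCons split: nat.splits)

lemma smult_polys_over:
  assumes "unital_subring A" "a \<in> A" "f \<in> polys_over A"
  shows "smult a f \<in> polys_over A"
  using assms unital_subringD(6)[OF assms(1)] by (auto simp: polys_over_def)

lemma const_polys_over:
  assumes "unital_subring A" "a \<in> A"
  shows "[:a:] \<in> polys_over A"
  using assms unital_subringD(2) by (auto simp: polys_over_def coeff_pCons split: nat.splits)

text \<open>
  Long division that multiplies by the leading coefficient of \<open>m\<close> in place of dividing by it, so that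
  all coefficients remain in \<open>A\<close>. The remainder is described by vanishing coefficients, which covers the
  remainder \<open>0\<close> uniformly.
\<close>

lemma pseudo_division_over_subring:
  assumes A: "unital_subring A" and m: "m \<in> polys_over A" and f: "f \<in> polys_over A"
  shows "\<exists>k r s. r \<in> polys_over A \<and> s \<in> polys_over A \<and>
    smult (lead_coeff m ^ k) f = m * r + s \<and> (\<forall>i\<ge>degree m. coeff s i = 0)"
proof -
  note a = unital_subringD[OF A] and p = unital_subringD[OF unital_subring_polys_over[OF A]]
  let ?a = "lead_coeff m"
  have "\<forall>i\<ge>n. coeff f i = 0 \<Longrightarrow> f \<in> polys_over A \<Longrightarrow> ?thesis" for n
  proof (induction n arbitrary: f)
    case 0
    then have "f = 0" by (simp add: poly_eq_iff)
    then show ?case using p(2) by (intro exI[of _ 0]) auto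
  next
    case (Suc n)
    show ?case
    proof (cases "degree m \<le> n")
      case False
      then show ?thesis
        using Suc.prems p(2) by (intro exI[of _ 0] exI[of _ f]) auto
    next
      case True
      \<comment> \<open>The multiple of \<open>m\<close> that cancels the coefficient of degree \<open>n\<close>.\<close>
      define q where "q = monom (coeff f n) (n - degree m)"
      have q: "q \<in> polys_over A" using Suc.prems(2) a(2) by (auto simp: q_def polys_over_def)
      define f' where "f' = smult ?a f - m * q"
      have f': "f' \<in> polys_over A"
        unfolding f'_def by (intro p smult_polys_over[OF A] m q Suc.prems polys_overD[OF m])
      have "coeff f' i = 0" if "i \<ge> n" for i
      proof (cases "i = n")
        case True
        then show ?thesis using \<open>degree m \<le> n\<close>
          by (simp add: f'_def q_def mult.commute[of m] coeff_monom_mult)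
      next
        case False
        then have "coeff f i = 0" using Suc.prems that by auto
        moreover have "coeff m (i - (n - degree m)) = 0"
          using False that \<open>degree m \<le> n\<close> by (intro coeff_eq_0) auto
        ultimately show ?thesis
          by (simp add: f'_def q_def mult.commute[of m] coeff_monom_mult)
      qed
      then obtain k r s where r: "r \<in> polys_over A" "s \<in> polys_over A"
        "smult (?a ^ k) f' = m * r + s" "\<forall>i\<ge>degree m. coeff s i = 0"
        using Suc.IH[OF _ f'] by blast
      have "smult (?a ^ Suc k) f = m * (r + smult (?a ^ k) q) + s"
        using r(3) by (simp add: f'_def algebra_simps smult_diff_right)
      moreover have "r + smult (?a ^ k) q \<in> polys_over A"
        by (intro p smult_polys_over[OF A] a r q polys_overD[OF m])
      ultimately show ?thesis using r by blast
    qed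
  qed
  from this[of "Suc (degree f)"] show ?thesis using f by (simp add: coeff_eq_0)
qed

text \<open>
  The ideal \<open>I[x] + m A[x]\<close>; its quotient is \<open>(A / I)[x]\<close> modulo the reduction of \<open>m\<close>.
\<close>

definition reduction_ideal :: "'a::comm_ring_1 set \<Rightarrow> 'a set \<Rightarrow> 'a poly \<Rightarrow> 'a poly set" where
  "reduction_ideal A I m = {f + r * m | f r. f \<in> polys_over I \<and> r \<in> polys_over A}"

lemma ideal_polys_over:
  assumes A: "unital_subring A" and I: "ideal_of A I"
  shows "ideal_of (polys_over A) (polys_over I)"
  using ideal_ofD[OF A I] polys_over_mult_ideal[OF A I] unfolding ideal_of_def
  by (auto simp: polys_over_def)

lemma ideal_reduction_ideal:
  assumes A: "unital_subring A" and I: "ideal_of A I" and m: "m \<in> polys_over A"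
  shows "ideal_of (polys_over A) (reduction_ideal A I m)"
    "polys_over I \<subseteq> reduction_ideal A I m" "m \<in> reduction_ideal A I m"
  using ideal_extend[OF unital_subring_polys_over[OF A] ideal_polys_over[OF A I] m]
  unfolding reduction_ideal_def by auto

text \<open>
  The powers of the leading coefficient introduced by pseudo-division can be undone modulo \<open>I\<close>.
\<close>

lemma lead_coeff_cancel_reduction_ideal:
  assumes A: "unital_subring A" and I: "prime_ideal_of A I" and fin: "finite_index A I"
    and m: "m \<in> polys_over A" and lc: "lead_coeff m \<notin> I"
  shows "\<exists>v\<in>A. \<forall>f\<in>polys_over A. f - smult v (smult (lead_coeff m ^ k) f) \<in> polys_over I"
proof -
  have idl: "ideal_of A I" using I by (simp add: prime_ideal_of_def)
  note a = unital_subringD[OF A] and i = ideal_ofD[OF A idl]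
  have "lead_coeff m ^ k \<notin> I" using prime_ideal_power[OF A I polys_overD[OF m]] lc by blast
  then obtain v where v: "v \<in> A" "1 - v * lead_coeff m ^ k \<in> I"
    using unit_mod_finite_prime[OF A I fin] a(7)[OF polys_overD[OF m]] by blast
  have "coeff (f - smult v (smult (lead_coeff m ^ k) f)) j \<in> I" if "f \<in> polys_over A" for f j
    using i(5)[OF polys_overD[OF that, of j] v(2)] by (simp add: algebra_simps)
  then show ?thesis using v(1) by (auto simp: polys_over_def)
qed

lemma reduction_ideal_cancel:
  assumes A: "unital_subring A" and I: "prime_ideal_of A I" and fin: "finite_index A I"
    and m: "m \<in> polys_over A" and lc: "lead_coeff m \<notin> I"
    and f: "f \<in> polys_over A" "smult (lead_coeff m ^ k) f \<in> reduction_ideal A I m"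
  shows "f \<in> reduction_ideal A I m"
proof -
  have idl: "ideal_of A I" using I by (simp add: prime_ideal_of_def)
  note J = ideal_reduction_ideal[OF A idl m]
  note j = ideal_ofD[OF unital_subring_polys_over[OF A] J(1)]
  obtain v where v: "v \<in> A" "f - smult v (smult (lead_coeff m ^ k) f) \<in> polys_over I"
    using lead_coeff_cancel_reduction_ideal[OF A I fin m lc] f(1) by blast
  have "[:v:] * smult (lead_coeff m ^ k) f \<in> reduction_ideal A I m"
    by (intro j(4) const_polys_over[OF A] v(1) f(2))
  then show ?thesis using j(3)[of "f - smult v (smult (lead_coeff m ^ k) f)" "smult v (smult (lead_coeff m ^ k) f)"] v(2) J(2)
    by (auto simp: mult.commute)
qed

text \<open>
  Modulo \<open>I\<close> and \<open>m\<close> every polynomial is, up to a unit of \<open>A / I\<close>, its remainder of degree below that of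
  \<open>m\<close>; reducing the finitely many coefficients of this remainder modulo \<open>I\<close> leaves finitely many
  possibilities.
\<close>

lemma finite_index_reduction_ideal:
  assumes A: "unital_subring A" and I: "prime_ideal_of A I" and fin: "finite_index A I"
    and m: "m \<in> polys_over A" and lc: "lead_coeff m \<notin> I"
  shows "finite_index (polys_over A) (reduction_ideal A I m)"
proof -
  have idl: "ideal_of A I" using I by (simp add: prime_ideal_of_def)
  note a = unital_subringD[OF A]
  note J = ideal_reduction_ideal[OF A idl m]
  note j = ideal_ofD[OF unital_subring_polys_over[OF A] J(1)]
  note i = ideal_ofD[OF A idl]
  obtain T where T: "finite T" "T \<subseteq> A" "\<And>x. x \<in> A \<Longrightarrow> \<exists>t\<in>T. x - t \<in> I"
    using fin unfolding finite_index_def by blast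
  then obtain \<rho> where \<rho>: "\<And>x. x \<in> A \<Longrightarrow> \<rho> x \<in> T" "\<And>x. x \<in> A \<Longrightarrow> x - \<rho> x \<in> I" by metis
  define build where "build = (\<lambda>v. \<Sum>i<degree m. monom (v i :: 'a) i)"
  have coeff_build: "coeff (build v) i = (if i < degree m then v i else 0)" for v i
    by (simp add: build_def coeff_sum)
  define Q where "Q = build ` (PiE {..<degree m} (\<lambda>_. T))"
  have "finite Q" using T(1) by (simp add: Q_def finite_PiE)
  moreover have "Q \<subseteq> polys_over A"
    using T(2) a(2) by (auto simp: Q_def polys_over_def coeff_build PiE_iff subset_iff)
  moreover have "\<exists>t\<in>Q. f - t \<in> reduction_ideal A I m" if f: "f \<in> polys_over A" for f
  proof -
    obtain k r s where r: "r \<in> polys_over A" "s \<in> polys_over A"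
      "smult (lead_coeff m ^ k) f = m * r + s" "\<forall>i\<ge>degree m. coeff s i = 0"
      using pseudo_division_over_subring[OF A m f] by blast
    obtain v where v: "v \<in> A" "f - smult v (smult (lead_coeff m ^ k) f) \<in> polys_over I"
      using lead_coeff_cancel_reduction_ideal[OF A I fin m lc] f by blast
    have vs: "smult v s \<in> polys_over A" by (intro smult_polys_over[OF A] v r)
    define t where "t = build (restrict (\<lambda>i. \<rho> (coeff (smult v s) i)) {..<degree m})"
    have "t \<in> Q" unfolding t_def Q_def
      using \<rho>(1)[OF polys_overD[OF vs]] by (intro imageI) (simp add: PiE_iff extensional_def)
    have "coeff (smult v s - t) n \<in> I" for n
    proof (cases "n < degree m")
      case True
      then show ?thesis using \<rho>(2)[OF polys_overD[OF vs, of n]] by (simp add: t_def coeff_build)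
    next
      case False
      then show ?thesis using r(4) i(1) by (simp add: t_def coeff_build)
    qed
    then have "smult v s - t \<in> polys_over I" by (simp add: polys_over_def)
    moreover have "m * smult v r \<in> reduction_ideal A I m"
      by (intro j(5) J smult_polys_over[OF A] v r)
    ultimately have "(f - smult v (smult (lead_coeff m ^ k) f)) + (m * smult v r + (smult v s - t))
        \<in> reduction_ideal A I m"
      using v(2) J(2) by (intro j(3)) auto
    also have "(f - smult v (smult (lead_coeff m ^ k) f)) + (m * smult v r + (smult v s - t)) = f - t"
      by (simp add: r(3) smult_add_right)
    finally show ?thesis using \<open>t \<in> Q\<close> by blast
  qed
  ultimately show ?thesis unfolding finite_index_def by blast
qed

text \<open>
  Over the domain \<open>A / I\<close> a nonzero multiple of a polynomial of positive degree is never constant.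
  Concretely, if \<open>j\<close> is the last index with \<open>coeff r j \<notin> I\<close>, then the coefficient of \<open>r m\<close> in degree
  \<open>j + degree m\<close> is nonzero modulo \<open>I\<close>.
\<close>

lemma const_in_reduction_ideal:
  assumes A: "unital_subring A" and I: "prime_ideal_of A I"
    and m: "m \<in> polys_over A" and lc: "lead_coeff m \<notin> I" and deg: "0 < degree m"
    and y: "[:y:] \<in> reduction_ideal A I m"
  shows "y \<in> I"
proof -
  have idl: "ideal_of A I" using I by (simp add: prime_ideal_of_def)
  note i = ideal_ofD[OF A idl]
  obtain f r where fr: "[:y:] = f + r * m" "f \<in> polys_over I" "r \<in> polys_over A"
    using y unfolding reduction_ideal_def by blast
  have "r \<in> polys_over I"
  proof (rule ccontr)
    assume "r \<notin> polys_over I"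
    then obtain j0 where j0: "coeff r j0 \<notin> I" by (auto simp: polys_over_def)
    have bnd: "\<forall>j. coeff r j \<notin> I \<longrightarrow> j \<le> degree r" using i(1) by (metis le_degree)
    obtain j where j: "coeff r j \<notin> I" "\<And>k. coeff r k \<notin> I \<Longrightarrow> k \<le> j"
      using Nat.ex_has_greatest_nat[of "\<lambda>j. coeff r j \<notin> I" j0 "degree r"] j0 bnd by blast
    let ?n = "j + degree m"
    have "coeff (r * m) ?n = (\<Sum>k\<le>?n. coeff r k * coeff m (?n - k))" by (rule coeff_mult)
    also have "\<dots> = coeff r j * lead_coeff m + (\<Sum>k\<in>{..?n} - {j}. coeff r k * coeff m (?n - k))"
      by (subst sum.remove[of _ j]) auto
    finally have "coeff r j * lead_coeff m
        = coeff (r * m) ?n - (\<Sum>k\<in>{..?n} - {j}. coeff r k * coeff m (?n - k))" by simp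
    moreover have "(\<Sum>k\<in>{..?n} - {j}. coeff r k * coeff m (?n - k)) \<in> I"
    proof (rule ideal_of_sum[OF A idl])
      fix k assume k: "k \<in> {..?n} - {j}"
      show "coeff r k * coeff m (?n - k) \<in> I"
      proof (cases "k < j")
        case True
        then have "coeff m (?n - k) = 0" by (intro coeff_eq_0) auto
        then show ?thesis using i(1) by simp
      next
        case False
        then have "coeff r k \<in> I" using j(2)[of k] k by force
        then show ?thesis using i(5) polys_overD[OF m] by blast
      qed
    qed
    moreover have "coeff (r * m) ?n \<in> I"
    proof -
      have "coeff (f + r * m) ?n = 0" unfolding fr(1)[symmetric] using deg
        by (simp add: coeff_pCons split: nat.splits)
      then have "coeff (r * m) ?n = - coeff f ?n" by (simp add: add_eq_0_iff)
      then show ?thesis using i(6) polys_overD[OF fr(2)] by simp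
    qed
    ultimately have "coeff r j * lead_coeff m \<in> I" using i(7) by simp
    then show False
      using prime_idealD[OF I polys_overD[OF fr(3)] polys_overD[OF m]] j(1) lc by blast
  qed
  then have "m * r \<in> polys_over I" by (rule polys_over_mult_ideal[OF A idl m])
  then have "coeff f 0 + coeff (m * r) 0 \<in> I" using i(3) fr(2) by (blast dest: polys_overD)
  moreover have "y = coeff f 0 + coeff (m * r) 0"
    using arg_cong[OF fr(1), of "\<lambda>q. coeff q 0"] by (simp add: mult.commute)
  ultimately show ?thesis by simp
qed

section \<open>Adjoining one element of a field\<close>

definition adjoin :: "'a::comm_ring_1 set \<Rightarrow> 'a \<Rightarrow> 'a set" where
  "adjoin A b = (\<lambda>f. poly f b) ` polys_over A"

lemma unital_subring_adjoin:
  assumes "unital_subring A" shows "unital_subring (adjoin A b)"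
  using unital_subringD[OF unital_subring_polys_over[OF assms]]
  unfolding unital_subring_def adjoin_def
  by (auto simp flip: poly_diff poly_mult) (metis image_eqI poly_1)

lemma adjoin_contains:
  assumes "unital_subring A" shows "A \<subseteq> adjoin A b" "b \<in> adjoin A b"
proof -
  note a = unital_subringD[OF assms]
  have "poly [:x:] b \<in> adjoin A b" if "x \<in> A" for x
    unfolding adjoin_def by (intro imageI const_polys_over[OF assms] that)
  then show "A \<subseteq> adjoin A b" by auto
  have "poly [:0, 1:] b \<in> adjoin A b"
    unfolding adjoin_def using const_polys_over[OF assms a(1)] a(2)
    by (intro imageI) (simp add: pCons_polys_over)
  then show "b \<in> adjoin A b" by simp
qed

lemma ideal_eval_image:
  assumes "ideal_of (polys_over A) J" 
  shows "ideal_of (adjoin A b) ((\<lambda>f. poly f b) ` J)"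
  using assms unfolding ideal_of_def adjoin_def
  by (auto simp flip: poly_add poly_mult) (metis image_eqI poly_0)

lemma finite_index_eval_image:
  assumes "finite_index (polys_over A) J" 
  shows "finite_index (adjoin A b) ((\<lambda>f. poly f b) ` J)"
proof -
  obtain T where T: "finite T" "T \<subseteq> polys_over A" "\<forall>x\<in>polys_over A. \<exists>t\<in>T. x - t \<in> J"
    using assms unfolding finite_index_def by blast
  then show ?thesis unfolding finite_index_def adjoin_def
    by (intro exI[of _ "(\<lambda>f. poly f b) ` T"]) (fastforce simp flip: poly_diff)
qed

text \<open>
  In field terms, \<open>c\<close> is algebraic over the fraction field of \<open>A\<close>, so \<open>1 / c\<close> is a fraction
  with numerator in \<open>A[b]\<close> and denominator in \<open>A\<close>. To find it, take a polynomial \<open>g\<close> of least degree whose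
  value at \<open>b\<close> is a nonzero multiple of \<open>c\<close>. If \<open>g\<close> were not constant, dividing \<open>m\<close> by \<open>g\<close> would give
  a remainder whose value is again a multiple of \<open>c\<close>, hence zero by minimality; the quotient would
  then be nonzero and annihilate \<open>b\<close>, although its degree is below that of \<open>m\<close>.
\<close>

lemma nonzero_multiple_in_base:
  fixes A :: "'a::field set"
  assumes A: "unital_subring A" and m: "m \<in> polys_over A" "m \<noteq> 0" "poly m b = 0"
    and min: "\<And>f. f \<in> polys_over A \<Longrightarrow> poly f b = 0 \<Longrightarrow> degree f < degree m \<Longrightarrow> f = 0"
    and c: "c \<in> adjoin A b" "c \<noteq> 0"
  shows "\<exists>e\<in>adjoin A b. c * e \<in> A \<and> c * e \<noteq> 0"
proof -
  note a = unital_subringD[OF A]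
  note B = unital_subringD[OF unital_subring_adjoin[OF A, of b]]
  have ev: "poly f b \<in> adjoin A b" if "f \<in> polys_over A" for f
    using that by (auto simp: adjoin_def)
  have dm: "0 < degree m"
  proof (rule ccontr)
    assume "\<not> 0 < degree m"
    then obtain x where "m = [:x:]" by (meson degree_eq_zeroE neq0_conv)
    then show False using m by simp
  qed
  define good where "good = (\<lambda>g. g \<in> polys_over A \<and> poly g b \<noteq> 0 \<and> (\<exists>e\<in>adjoin A b. poly g b = c * e))"
  obtain q where q: "q \<in> polys_over A" "poly q b = c" using c(1) by (auto simp: adjoin_def)
  \<comment> \<open>Reducing a representative of \<open>c\<close> modulo \<open>m\<close> shows that the least degree is below that of \<open>m\<close>.\<close>
  obtain k r s where s: "r \<in> polys_over A" "s \<in> polys_over A"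
    "smult (lead_coeff m ^ k) q = m * r + s" "\<forall>i\<ge>degree m. coeff s i = 0"
    using pseudo_division_over_subring[OF A m(1) q(1)] by blast
  have sb: "poly s b = c * lead_coeff m ^ k"
    using arg_cong[OF s(3), of "\<lambda>f. poly f b"] m(3) q(2) by (simp add: mult.commute)
  have "lead_coeff m ^ k \<in> adjoin A b"
    using adjoin_contains(1)[OF A] a(7) polys_overD[OF m(1)] by blast
  then have gs: "good s" unfolding good_def using sb s(2) c(2) m(2) by auto
  define g where "g = arg_min degree good"
  have g: "good g" and gmin: "\<And>h. good h \<Longrightarrow> degree g \<le> degree h"
    using arg_min_nat_lemma[of good s degree] gs unfolding g_def by auto
  have "s \<noteq> 0" using gs by (auto simp: good_def)
  then have "degree s < degree m" using s(4) by (metis leading_coeff_0_iff not_le)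
  then have gm: "degree g < degree m" using gmin[OF gs] by simp
  have gA: "g \<in> polys_over A" and g0: "g \<noteq> 0" using g by (auto simp: good_def)
  have "degree g = 0"
  proof (rule ccontr)
    assume dg: "degree g \<noteq> 0"
    obtain k r s where s: "r \<in> polys_over A" "s \<in> polys_over A"
      "smult (lead_coeff g ^ k) m = g * r + s" "\<forall>i\<ge>degree g. coeff s i = 0"
      using pseudo_division_over_subring[OF A gA m(1)] by blast
    have ds: "degree s < degree g" using s(4) dg
      by (metis bot_nat_0.not_eq_extremum degree_0 leading_coeff_0_iff not_le)
    have sr: "poly s b = - (poly g b * poly r b)"
      using arg_cong[OF s(3), of "\<lambda>f. poly f b"] m(3) by (simp add: add_eq_0_iff)
    obtain e where e: "e \<in> adjoin A b" "poly g b = c * e" using g by (auto simp: good_def)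
    have "poly s b = c * (- (e * poly r b))" using sr e by simp
    moreover have "- (e * poly r b) \<in> adjoin A b" by (intro B e ev s)
    moreover have "\<not> good s" using gmin[of s] ds by auto
    ultimately have "poly s b = 0" using s(2) unfolding good_def by blast
    then have rb: "poly r b = 0" using sr g by (auto simp: good_def)
    have "degree (smult (lead_coeff g ^ k) m) = degree m" using g0 by simp
    moreover have "g * r = smult (lead_coeff g ^ k) m - s" using s(3) by simp
    ultimately have "degree (g * r) \<le> degree m" using ds gm by (auto intro!: degree_diff_le)
    then have "r = 0" using min[OF s(1) rb] dg degree_mult_eq[OF g0, of r] by fastforce
    then have "degree m = degree s" using arg_cong[OF s(3), of degree] g0 by simp
    then show False using ds gm by simp
  qed
  then obtain x where "g = [:x:]" by (meson degree_eq_zeroE)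
  then have "x \<in> A" "poly g b = x" using gA by (auto simp: pCons_polys_over)
  then show ?thesis using g unfolding good_def by metis
qed

text \<open>
  Each of the two choices of \<open>m\<close> is made so that no power of \<open>c\<close> lies in the image of the reduction
  ideal. When \<open>b\<close> is algebraic, the reduction ideal of its annihilator of minimal degree
  contains every polynomial vanishing at \<open>b\<close>, so that membership in its image can be tested in \<open>A[x]\<close>.
  A multiple of \<open>c\<close> in \<open>A\<close> that avoids \<open>I\<close> then keeps all powers of \<open>c\<close> out of the image.
  When \<open>b\<close> is transcendental, evaluation at \<open>b\<close> is injective on \<open>A[x]\<close>, and the congruence
  \<open>x p = 1\<close> modulo \<open>m = 1 - x p\<close> would turn a power of \<open>p\<close> in the ideal into \<open>1\<close>.
\<close>

lemma separated_adjoin: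
  fixes A :: "'a::field set"
  assumes A: "unital_subring A" and sep: "separated_by_finite_primes A"
  shows "separated_by_finite_primes (adjoin A b)"
  unfolding separated_by_finite_primes_def
proof (intro ballI impI)
  fix c assume c: "c \<in> adjoin A b" "c \<noteq> 0"
  note a = unital_subringD[OF A] and p = unital_subringD[OF unital_subring_polys_over[OF A]]
  have B: "unital_subring (adjoin A b)" by (rule unital_subring_adjoin[OF A])
  note const = const_polys_over[OF A]
  have sep: "\<exists>P. prime_ideal_of A P \<and> finite_index A P \<and> x \<notin> P" if "x \<in> A" "x \<noteq> 0" for x
    using sep that by (auto simp: separated_by_finite_primes_def)
  have prime_from: "\<exists>P. prime_ideal_of (adjoin A b) P \<and> finite_index (adjoin A b) P \<and> c \<notin> P"
    if I: "prime_ideal_of A I" "finite_index A I" and m: "m \<in> polys_over A" "lead_coeff m \<notin> I"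
      and av: "\<And>k. c ^ k \<notin> (\<lambda>f. poly f b) ` reduction_ideal A I m" for I m
  proof (rule finite_index_prime_avoiding[OF B _ _ c(1) av])
    have "ideal_of A I" using I by (simp add: prime_ideal_of_def)
    then show "ideal_of (adjoin A b) ((\<lambda>f. poly f b) ` reduction_ideal A I m)"
      by (intro ideal_eval_image ideal_reduction_ideal A m)
    show "finite_index (adjoin A b) ((\<lambda>f. poly f b) ` reduction_ideal A I m)"
      by (intro finite_index_eval_image finite_index_reduction_ideal A I m)
  qed
  show "\<exists>P. prime_ideal_of (adjoin A b) P \<and> finite_index (adjoin A b) P \<and> c \<notin> P"
  proof (cases "\<exists>f\<in>polys_over A. f \<noteq> 0 \<and> poly f b = 0")
    case True
    define ann where "ann = (\<lambda>f. f \<in> polys_over A \<and> f \<noteq> 0 \<and> poly f b = 0)"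
    define m where "m = arg_min degree ann"
    have "ann m" and mmin: "\<And>h. ann h \<Longrightarrow> degree m \<le> degree h"
      using arg_min_nat_lemma[of ann _ degree] True unfolding m_def ann_def by blast+
    then have m: "m \<in> polys_over A" "m \<noteq> 0" "poly m b = 0" by (auto simp: ann_def)
    have min: "f = 0" if "f \<in> polys_over A" "poly f b = 0" "degree f < degree m" for f
      using mmin[of f] that by (auto simp: ann_def)
    obtain e where e: "e \<in> adjoin A b" "c * e \<in> A" "c * e \<noteq> 0"
      using nonzero_multiple_in_base[OF A m min c] by blast
    have la: "lead_coeff m \<in> A" using polys_overD[OF m(1)] .
    \<comment> \<open>One prime has to avoid both the leading coefficient and the multiple of \<open>c\<close>, hence their product.\<close>
    obtain I where I: "prime_ideal_of A I" "finite_index A I" "lead_coeff m * (c * e) \<notin> I"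
      using sep[of "lead_coeff m * (c * e)"] a(6)[OF la e(2)] e(3) m(2) by auto
    have idl: "ideal_of A I" using I by (simp add: prime_ideal_of_def)
    note i = ideal_ofD[OF A idl]
    have lc: "lead_coeff m \<notin> I" and ce: "c * e \<notin> I" using I(3) i(4,5) la e(2) by blast+
    let ?J = "reduction_ideal A I m"
    note J = ideal_reduction_ideal[OF A idl m(1)]
    note j = ideal_ofD[OF unital_subring_polys_over[OF A] J(1)]
    have dm: "0 < degree m"
    proof (rule ccontr)
      assume "\<not> 0 < degree m"
      then obtain x where "m = [:x:]" by (meson degree_eq_zeroE neq0_conv)
      then show False using m by simp
    qed
    have ker: "f \<in> ?J" if f: "f \<in> polys_over A" "poly f b = 0" for f
    proof -
      obtain k r s where s: "r \<in> polys_over A" "s \<in> polys_over A"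
        "smult (lead_coeff m ^ k) f = m * r + s" "\<forall>i\<ge>degree m. coeff s i = 0"
        using pseudo_division_over_subring[OF A m(1) f(1)] by blast
      have "poly s b = 0" using arg_cong[OF s(3), of "\<lambda>f. poly f b"] m(3) f(2) by simp
      moreover have "s = 0 \<or> degree s < degree m" using s(4) by (metis leading_coeff_0_iff not_le)
      ultimately have "s = 0" using min[OF s(2)] by blast
      then have "smult (lead_coeff m ^ k) f \<in> ?J" using s j(5)[OF s(1) J(3)] by simp
      then show ?thesis by (rule reduction_ideal_cancel[OF A I(1,2) m(1) lc f(1)])
    qed
    show ?thesis
    proof (rule prime_from[OF I(1,2) m(1) lc])
      fix k
      show "c ^ k \<notin> (\<lambda>f. poly f b) ` ?J"
      proof
        assume "c ^ k \<in> (\<lambda>f. poly f b) ` ?J"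
        then obtain f where f: "f \<in> ?J" "poly f b = c ^ k" by auto
        obtain h where h: "h \<in> polys_over A" "poly h b = e" using e(1) by (auto simp: adjoin_def)
        have fh: "f * h ^ k \<in> ?J" by (intro j(5) p(7) f h)
        have "[:(c * e) ^ k:] - f * h ^ k \<in> ?J"
        proof (rule ker)
          show "[:(c * e) ^ k:] - f * h ^ k \<in> polys_over A" by (intro p(3) const a(7) e(2) j(2) fh)
          show "poly ([:(c * e) ^ k:] - f * h ^ k) b = 0" by (simp add: f h power_mult_distrib)
        qed
        then have "[:(c * e) ^ k:] \<in> ?J" using j(3)[OF _ fh] by fastforce
        then have "(c * e) ^ k \<in> I" by (rule const_in_reduction_ideal[OF A I(1) m(1) lc dm])
        then show False using prime_ideal_power[OF A I(1) e(2)] ce by blast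
      qed
    qed
  next
    case False
    obtain q where q: "q \<in> polys_over A" "poly q b = c" using c(1) by (auto simp: adjoin_def)
    have q0: "q \<noteq> 0" using q(2) c(2) by auto
    obtain I where I: "prime_ideal_of A I" "finite_index A I" "lead_coeff q \<notin> I"
      using sep[of "lead_coeff q"] polys_overD[OF q(1)] q0 by auto
    have idl: "ideal_of A I" using I by (simp add: prime_ideal_of_def)
    \<comment> \<open>This is \<open>1 - x q\<close>.\<close>
    define m where "m = pCons 1 (- q)"
    have m: "m \<in> polys_over A" using q p(4)[OF q(1)] a(1) by (auto simp: m_def pCons_polys_over)
    have dm: "0 < degree m" and lm: "lead_coeff m = - lead_coeff q"
      using q0 by (auto simp: m_def)
    have lc: "lead_coeff m \<notin> I" using ideal_ofD(6)[OF A idl] I(3) lm by force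
    let ?J = "reduction_ideal A I m"
    note J = ideal_reduction_ideal[OF A idl m]
    note j = ideal_ofD[OF unital_subring_polys_over[OF A] J(1)]
    have X: "[:0, 1:] \<in> polys_over A" using const_polys_over[OF A a(1)] a(2) by (simp add: pCons_polys_over)
    show ?thesis
    proof (rule prime_from[OF I(1,2) m lc])
      fix k
      show "c ^ k \<notin> (\<lambda>f. poly f b) ` ?J"
      proof
        assume "c ^ k \<in> (\<lambda>f. poly f b) ` ?J"
        then obtain f where f: "f \<in> ?J" "poly f b = c ^ k" by auto
        have "poly (f - q ^ k) b = 0" "f - q ^ k \<in> polys_over A"
          using f q by (auto intro: p j)
        then have "f = q ^ k" using False by auto
        have step: "q ^ i \<in> ?J \<Longrightarrow> 1 \<in> ?J" for i
        proof (induction i)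
          case (Suc i)
          have "q ^ i * m + [:0, 1:] * q ^ Suc i \<in> ?J"
            by (intro j(3) j(4) J X Suc.prems p q)
          also have "q ^ i * m + [:0, 1:] * q ^ Suc i = q ^ i"
            unfolding m_def by (simp add: algebra_simps)
          finally show ?case by (rule Suc.IH)
        qed simp
        have "[:1:] \<in> ?J" using step f(1) \<open>f = q ^ k\<close> by (simp add: one_pCons)
        then have "1 \<in> I" by (rule const_in_reduction_ideal[OF A I(1) m lc dm])
        then show False using I(1) by (simp add: prime_ideal_of_def)
      qed
    qed
  qed
qed

section \<open>Finite quotients of finitely generated subrings\<close>

lemma unital_subring_Ints: "unital_subring \<int>"
  by (auto simp: unital_subring_def)

text \<open>
  The prime ring, image of the integers, starts the induction. In characteristic zero a prime \<open>p\<close> larger than the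
  given integer works; in characteristic \<open>p\<close> the ideal generated by \<open>p\<close> is zero, and the prime ring is
  itself finite. The property of \<open>p\<close> stated first makes the two cases alike afterwards.
\<close>

lemma separated_Ints: "separated_by_finite_primes (\<int> :: 'a::field set)"
  unfolding separated_by_finite_primes_def
proof (intro ballI impI)
  fix c :: 'a assume "c \<in> \<int>" "c \<noteq> 0"
  then obtain z where z: "c = of_int z" "z \<noteq> 0" by (metis Ints_cases of_int_0)
  have "\<exists>p::nat. prime p \<and> (\<forall>x::int. of_int x \<in> ((\<lambda>k. of_int (int p * k)) ` UNIV :: 'a set) \<longrightarrow> int p dvd x)
      \<and> \<not> int p dvd z"
  proof (cases "CHAR('a) = 0")
    case True
    have "of_int x = (of_int y :: 'a) \<longleftrightarrow> x = y" for x y :: int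
    proof -
      have "of_int x = (of_int y :: 'a) \<longleftrightarrow> of_int (x - y) = (0 :: 'a)" by simp
      also have "\<dots> \<longleftrightarrow> x = y" unfolding of_int_eq_0_iff_char_dvd True by simp
      finally show ?thesis .
    qed
    moreover obtain p :: nat where "prime p" "nat \<bar>z\<bar> < p" using bigger_prime by blast
    moreover from this z(2) have "\<not> int p dvd z" using zdvd_imp_le[of "int p" "\<bar>z\<bar>"] by fastforce
    moreover have "int p dvd x" if x: "of_int x \<in> ((\<lambda>k. of_int (int p * k)) ` UNIV :: 'a set)" for x
    proof -
      obtain k where k: "of_int x = (of_int (int p * k) :: 'a)" using x by blast
      then show ?thesis unfolding \<open>\<And>x y. (of_int x = (of_int y :: 'a)) = (x = y)\<close> by simp
    qed
    ultimately show ?thesis by blast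
  next
    case False
    define p where "p = CHAR('a)"
    have z': "of_int x = (0 :: 'a) \<longleftrightarrow> int p dvd x" for x :: int
      unfolding p_def by (rule of_int_eq_0_iff_char_dvd)
    have "prime p" unfolding p_def using False by (intro prime_CHAR_semidom) simp
    moreover have "int p dvd x" if x: "of_int x \<in> ((\<lambda>k. of_int (int p * k)) ` UNIV :: 'a set)" for x
    proof -
      obtain k where k: "of_int x = (of_int (int p * k) :: 'a)" using x by blast
      have "of_int (int p * k) = (0 :: 'a)" unfolding z' by simp
      then show ?thesis using k z' by metis
    qed
    moreover have "\<not> int p dvd z" using z' z \<open>c \<noteq> 0\<close> by metis
    ultimately show ?thesis by blast
  qed
  then obtain p :: nat where p: "prime p" and nz: "\<not> int p dvd z"
    and mem: "\<And>x::int. of_int x \<in> ((\<lambda>k. of_int (int p * k)) ` UNIV :: 'a set) \<Longrightarrow> int p dvd x" by blast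
  define P :: "'a set" where "P = (\<lambda>k. of_int (int p * k)) ` UNIV"
  have memP: "of_int x \<in> P \<longleftrightarrow> int p dvd x" for x
    using mem[of x] unfolding P_def by (auto simp del: of_int_mult)
  have PI: "P \<subseteq> \<int>" unfolding P_def by auto
  have idl: "ideal_of \<int> P"
    unfolding ideal_of_def
  proof (intro conjI ballI PI)
    show "0 \<in> P" using memP[of 0] by simp
    show "x + y \<in> P" if xy: "x \<in> P" "y \<in> P" for x y
    proof -
      obtain k l where "x = of_int k" "y = of_int l" using xy PI by (meson Ints_cases subsetD)
      then show ?thesis using memP[of k] memP[of l] memP[of "k + l"] xy by simp
    qed
    show "x * y \<in> P" if xy: "x \<in> \<int>" "y \<in> P" for x y
    proof -
      obtain k l where "x = of_int k" "y = of_int l" using xy PI by (meson Ints_cases subsetD)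
      then show ?thesis using memP[of l] memP[of "k * l"] xy by simp
    qed
  qed
  have "prime_ideal_of \<int> P"
    unfolding prime_ideal_of_def
  proof (intro conjI ballI impI idl)
    show "1 \<notin> P" using memP[of 1] p by (auto simp: prime_gt_1_nat)
    fix x y assume xy: "x \<in> \<int>" "y \<in> \<int>" "x * y \<in> P"
    then obtain k l where "x = of_int k" "y = of_int l" by (meson Ints_cases)
    then show "x \<in> P \<or> y \<in> P"
      using memP[of k] memP[of l] memP[of "k * l"] xy p by (simp add: prime_dvd_mult_iff)
  qed
  moreover have "finite_index \<int> P"
    unfolding finite_index_def
  proof (intro exI[of _ "of_int ` {0..<int p}"] conjI ballI)
    fix x :: 'a assume "x \<in> \<int>"
    then obtain k where k: "x = of_int k" by (meson Ints_cases)
    have "of_int (k - k mod int p) \<in> P" unfolding memP by (simp add: dvd_minus_mod)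
    then show "\<exists>t\<in>of_int ` {0..<int p}. x - t \<in> P"
      using p unfolding k by (auto intro!: bexI[of _ "k mod int p"] simp: prime_gt_0_nat)
  qed auto
  moreover have "c \<notin> P" using memP z nz by simp
  ultimately show "\<exists>P. prime_ideal_of \<int> P \<and> finite_index \<int> P \<and> c \<notin> P" by blast
qed

theorem separated_subring_containing:
  fixes S :: "'a::field set"
  assumes "finite S"
  shows "\<exists>A. unital_subring A \<and> S \<subseteq> A \<and> separated_by_finite_primes A"
  using assms
proof induction
  case empty
  then show ?case using unital_subring_Ints separated_Ints by blast
next
  case (insert b S)
  then obtain A where A: "unital_subring A" "S \<subseteq> A" "separated_by_finite_primes A" by blast
  then show ?case
    using unital_subring_adjoin[OF A(1)] adjoin_contains[OF A(1), of b] separated_adjoin[OF A(1,3)]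
    by (intro exI[of _ "adjoin A b"]) auto
qed

section \<open>The action of the group ring on configurations\<close>

text \<open>
  The group ring acts by right translations of the argument. They commute with the shift, which
  translates on the left, and their order of composition agrees with the convolution product, so this
  is a left action even when the group is not commutative.
\<close>

definition act :: "('g::group_add \<Rightarrow>\<^sub>0 'k::comm_ring_1) \<Rightarrow> ('g \<Rightarrow> 'k) \<Rightarrow> 'g \<Rightarrow> 'k" where
  "act m x g = (\<Sum>h\<in>Poly_Mapping.keys m. Poly_Mapping.lookup m h * x (g + h))"

lemma act_superset:
  assumes "finite H" "Poly_Mapping.keys m \<subseteq> H"
  shows "act m x g = (\<Sum>h\<in>H. Poly_Mapping.lookup m h * x (g + h))"
  unfolding act_def using assms by (intro sum.mono_neutral_left) (auto simp: in_keys_iff)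

lemma act_0 [simp]: "act 0 x = (\<lambda>g. 0)"
  by (rule ext) (simp add: act_def)

lemma act_single: "act (Poly_Mapping.single h a) x = (\<lambda>g. a * x (g + h))"
  by (rule ext, subst act_superset[of "{h}"]) auto

lemma act_add: "act (m + n) x = (\<lambda>g. act m x g + act n x g)"
proof
  fix g
  let ?H = "Poly_Mapping.keys m \<union> Poly_Mapping.keys n"
  show "act (m + n) x g = act m x g + act n x g"
    by (subst (1 2 3) act_superset[of ?H])
      (auto simp: Poly_Mapping.keys_add lookup_add distrib_right sum.distrib)
qed

lemma act_one: "act 1 x = x"
  unfolding single_one[symmetric] act_single by simp

lemma act_add_right: "act m (\<lambda>g. x g + y g) = (\<lambda>g. act m x g + act m y g)"
  by (rule ext) (simp add: act_def distrib_left sum.distrib)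

lemma poly_mapping_add_induct [case_names zero single add]:
  fixes f :: "'a \<Rightarrow>\<^sub>0 'b::comm_monoid_add"
  assumes "P 0" "\<And>k v. P (Poly_Mapping.single k v)" "\<And>f g. P f \<Longrightarrow> P g \<Longrightarrow> P (f + g)"
  shows "P f"
proof -
  have "f = (\<Sum>k\<in>Poly_Mapping.keys f. Poly_Mapping.single k (Poly_Mapping.lookup f k))"
    by (rule poly_mapping_eqI) (auto simp: lookup_sum lookup_single when_def in_keys_iff)
  moreover have "P (\<Sum>k\<in>K. Poly_Mapping.single k (Poly_Mapping.lookup f k))" for K
    by (induction K rule: infinite_finite_induct) (auto intro: assms)
  ultimately show ?thesis by metis
qed

text \<open>
  Both sides are additive in \<open>m\<close> and in \<open>n\<close>, which reduces the claim to monomials; there it is the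
  associativity of the group.
\<close>

lemma act_mult: "act (m * n) x = act m (act n x)"
proof (induction m rule: poly_mapping_add_induct)
  case zero
  show ?case by simp
next
  case (single h a)
  show ?case
  proof (induction n rule: poly_mapping_add_induct)
    case zero
    show ?case by (simp add: act_single)
  next
    case (single h' b)
    show ?case by (simp add: mult_single act_single add.assoc mult.assoc)
  next
    case (add f1 f2)
    then show ?case by (simp add: distrib_left act_add act_add_right)
  qed
next
  case (add f1 f2)
  then show ?case by (simp add: distrib_right act_add)
qed

lemma act_sum: "act (\<Sum>i\<in>S. f i) x g = (\<Sum>i\<in>S. act (f i) x g)"
  by (induction S rule: infinite_finite_induct) (auto simp: act_add)

lemma act_sum_right: "act m (\<lambda>g. \<Sum>i\<in>S. f i g) g' = (\<Sum>i\<in>S. act m (f i) g')"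
  unfolding act_def by (subst sum.swap) (simp add: sum_distrib_left)

lemma act_shift: "act m (\<lambda>g. x (\<gamma> + g)) g = act m x (\<gamma> + g)"
  by (simp add: act_def add.assoc)

definition mat_act :: "('g::group_add \<Rightarrow>\<^sub>0 'k::comm_ring_1) mat \<Rightarrow> ('g \<Rightarrow> nat \<Rightarrow> 'k) \<Rightarrow> 'g \<Rightarrow> nat \<Rightarrow> 'k" where
  "mat_act M x g i = (\<Sum>j<dim_col M. act (M $$ (i, j)) (\<lambda>h. x h j) g)"

lemma mat_act_mult:
  assumes "X \<in> carrier_mat d d" "Y \<in> carrier_mat d d" "i < d"
  shows "mat_act (X * Y) x g i = mat_act X (mat_act Y x) g i"
proof -
  have "mat_act (X * Y) x g i = (\<Sum>k<d. \<Sum>j<d. act (X $$ (i, j)) (act (Y $$ (j, k)) (\<lambda>h. x h k)) g)"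
    using assms by (simp add: mat_act_def scalar_prod_def act_sum act_mult lessThan_atLeast0)
  also have "\<dots> = mat_act X (mat_act Y x) g i"
    using assms by (subst sum.swap) (simp add: mat_act_def act_sum_right)
  finally show ?thesis .
qed

lemma mat_act_one:
  assumes "i < d"
  shows "mat_act (1\<^sub>m d) x g i = x g i"
proof -
  have "mat_act (1\<^sub>m d) x g i = (\<Sum>j<d. if j = i then x g i else 0)"
    unfolding mat_act_def using assms by (intro sum.cong) (auto simp: act_one)
  then show ?thesis using assms by simp
qed

section \<open>Matrices as cellular automata modulo an ideal\<close>

text \<open>
  The easy half of the Curtis--Hedlund--Lyndon theorem: fixing the finitely many coordinates on which the
  map depends cuts out an open neighbourhood on which the map is constant.
\<close>

lemma continuous_map_local_rule:
  fixes \<phi> :: "('g \<Rightarrow> 'a) \<Rightarrow> 'b"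
  assumes fin: "finite D" and into: "\<And>x. x \<in> topspace (full_shift F) \<Longrightarrow> \<phi> x \<in> G"
    and loc: "\<And>x y. x \<in> topspace (full_shift F) \<Longrightarrow> y \<in> topspace (full_shift F) \<Longrightarrow>
      (\<And>h. h \<in> D \<Longrightarrow> x h = y h) \<Longrightarrow> \<phi> x = \<phi> y"
  shows "continuous_map (full_shift F) (discrete_topology G) \<phi>"
  unfolding continuous_map_def
proof (intro conjI allI impI)
  show "\<phi> \<in> topspace (full_shift F) \<rightarrow> topspace (discrete_topology G)" using into by auto
  fix U assume "openin (discrete_topology G) U"
  show "openin (full_shift F) {x \<in> topspace (full_shift F). \<phi> x \<in> U}"
  proof (subst openin_subopen, intro ballI)
    fix x assume x: "x \<in> {x \<in> topspace (full_shift F). \<phi> x \<in> U}"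
    let ?N = "PiE UNIV (\<lambda>h. if h \<in> D then {x h} else F)"
    have "openin (full_shift F) ?N"
      unfolding full_shift_def
    proof (rule product_topology_basis)
      show "openin (discrete_topology F) (if h \<in> D then {x h} else F)" for h
        using x by (auto simp: topspace_full_shift)
      show "finite {h. (if h \<in> D then {x h} else F) \<noteq> topspace (discrete_topology F)}"
        using fin by (rule finite_subset[rotated]) auto
    qed
    moreover have "x \<in> ?N" using x by (auto simp: topspace_full_shift)
    moreover have "?N \<subseteq> {x \<in> topspace (full_shift F). \<phi> x \<in> U}"
    proof
      fix y assume y: "y \<in> ?N"
      have yF: "y \<in> topspace (full_shift F)"
        unfolding topspace_full_shift
      proof
        fix h
        have "y h \<in> (if h \<in> D then {x h} else F)" using y by (simp add: PiE_iff extensional_def)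
        then show "y h \<in> F" using x by (auto simp: topspace_full_shift split: if_splits)
      qed
      have "y h = x h" if "h \<in> D" for h
      proof -
        have "y h \<in> (if h \<in> D then {x h} else F)" using y by (simp add: PiE_iff extensional_def)
        then show ?thesis using that by simp
      qed
      then have "\<phi> y = \<phi> x" using loc[OF yF, of x] x by auto
      then show "y \<in> {x \<in> topspace (full_shift F). \<phi> x \<in> U}" using yF x by auto
    qed
    ultimately show "\<exists>T. openin (full_shift F) T \<and> x \<in> T \<and> T \<subseteq> {x \<in> topspace (full_shift F). \<phi> x \<in> U}"
      by blast
  qed
qed

definition coeffs_in :: "'k set \<Rightarrow> ('g \<Rightarrow>\<^sub>0 'k::zero) mat \<Rightarrow> bool" where
  "coeffs_in A M \<longleftrightarrow> (\<forall>i<dim_row M. \<forall>j<dim_col M. \<forall>h. Poly_Mapping.lookup (M $$ (i, j)) h \<in> A)"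

lemma mat_act_in:
  assumes "unital_subring A" "M \<in> carrier_mat d d" "coeffs_in A M" "i < d"
    and "\<And>g j. j < d \<Longrightarrow> x g j \<in> A"
  shows "mat_act M x g i \<in> A"
  using assms unfolding mat_act_def act_def coeffs_in_def
  by (auto intro!: unital_subring_sum[OF assms(1)] unital_subringD(6)[OF assms(1)])

lemma mat_act_cong_mod:
  assumes A: "unital_subring A" "ideal_of A I" and M: "M \<in> carrier_mat d d" "coeffs_in A M" "i < d"
    and xy: "\<And>g j. j < d \<Longrightarrow> x g j - y g j \<in> I"
  shows "mat_act M x g i - mat_act M y g i \<in> I"
proof -
  have "mat_act M x g i - mat_act M y g i =
    (\<Sum>j<d. \<Sum>h\<in>Poly_Mapping.keys (M $$ (i, j)). Poly_Mapping.lookup (M $$ (i, j)) h * (x (g + h) j - y (g + h) j))"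
    using M(1) by (simp add: mat_act_def act_def right_diff_distrib sum_subtractf)
  also have "\<dots> \<in> I"
    using M xy unfolding coeffs_in_def by (auto intro!: ideal_of_sum[OF A] ideal_ofD(4)[OF A])
  finally show ?thesis .
qed

text \<open>
  Configurations supported at one point recover the coefficients of the matrix. Since the action
  translates by \<open>g + h\<close>, placing the point at \<open>h\<close> and reading at \<open>0\<close> gives the coefficient
  of \<open>h\<close>.
\<close>

lemma mat_act_delta:
  assumes "M \<in> carrier_mat d d" "i < d" "j < d"
  shows "mat_act M (\<lambda>g k. if g = h \<and> k = j then 1 else 0) 0 i = Poly_Mapping.lookup (M $$ (i, j)) h"
proof -
  have *: "act m (\<lambda>g. if g = h \<and> k = j then 1 else 0) 0 = (if k = j then Poly_Mapping.lookup m h else 0)"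
    for m :: "'a \<Rightarrow>\<^sub>0 'b" and k
  proof (cases "k = j")
    case True
    then have "act m (\<lambda>g. if g = h \<and> k = j then 1 else 0) 0
        = (\<Sum>k\<in>Poly_Mapping.keys m. if k = h then Poly_Mapping.lookup m k else 0)"
      unfolding act_def by (intro sum.cong) auto
    then show ?thesis using True by (simp add: in_keys_iff)
  qed (simp add: act_def)
  show ?thesis unfolding mat_act_def * using assms by simp
qed

text \<open>
  The alphabet is \<open>(A / I)\<^sup>d\<close>, realised by vectors of chosen coset representatives, so
  that configurations over it are configurations over \<open>A\<close> on which the matrices act directly. After
  each action the entries are replaced by their representatives; as the action respects congruence
  modulo \<open>I\<close>, it does not matter whether this is done after each step or once at the end. Thus \<open>X Y = 1\<close> makes the
  automaton of \<open>Y\<close> injective, surjunctivity makes it bijective with the automaton of \<open>X\<close> as inverse,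
  and point configurations translate the composite in the other order into coefficients of \<open>Y X\<close>.
\<close>

lemma surjunctive_left_inverse_mod_ideal:
  fixes X Y :: "('g::group_add \<Rightarrow>\<^sub>0 'k::comm_ring_1) mat"
  assumes surj: "surjunctive TYPE('g)"
    and A: "unital_subring A" and I: "ideal_of A I" and fin: "finite_index A I"
    and X: "X \<in> carrier_mat d d" "coeffs_in A X" and Y: "Y \<in> carrier_mat d d" "coeffs_in A Y"
    and XY: "X * Y = 1\<^sub>m d" and ij: "i < d" "j < d"
  shows "Poly_Mapping.lookup ((Y * X) $$ (i, j)) h - Poly_Mapping.lookup (1\<^sub>m d $$ (i, j)) h \<in> I"
proof -
  note i = ideal_ofD[OF A I]
  obtain T where T: "finite T" "T \<subseteq> A" "\<And>x. x \<in> A \<Longrightarrow> \<exists>t\<in>T. x - t \<in> I"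
    using fin unfolding finite_index_def by blast
  \<comment> \<open>The choice depends only on the coset of \<open>x\<close>, because congruent elements satisfy the same predicate.\<close>
  define \<rho> where "\<rho> x = (SOME t. t \<in> T \<and> x - t \<in> I)" for x
  have \<rho>: "\<rho> x \<in> T" "x - \<rho> x \<in> I" if "x \<in> A" for x
    using someI_ex[of "\<lambda>t. t \<in> T \<and> x - t \<in> I"] T(3)[OF that] unfolding \<rho>_def by blast+
  have \<rho>A: "\<rho> x \<in> A" if "x \<in> A" for x using \<rho>(1)[OF that] T(2) by blast
  have \<rho>_cong: "\<rho> x = \<rho> y" if "x - y \<in> I" for x y
  proof -
    have "x - t \<in> I \<longleftrightarrow> y - t \<in> I" for t
      using i(3)[OF that, of "y - t"] i(7)[OF _ that, of "x - t"] by (auto simp: algebra_simps)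
    then show ?thesis by (simp add: \<rho>_def)
  qed
  have \<rho>_eqD: "x - y \<in> I" if "\<rho> x = \<rho> y" "x \<in> A" "y \<in> A" for x y
    using i(7)[OF \<rho>(2)[OF that(2)] \<rho>(2)[OF that(3)]] that(1) by simp
  have \<rho>\<rho>: "\<rho> (\<rho> x) = \<rho> x" if "x \<in> A" for x
    using \<rho>_cong[OF \<rho>(2)[OF that]] by simp
  \<comment> \<open>Letters take the default value from index \<open>d\<close> on; otherwise the alphabet would be infinite.\<close>
  define F where "F = PiE {..<d} (\<lambda>_. \<rho> ` A)"
  have "\<rho> ` A \<subseteq> T" using \<rho>(1) by blast
  then have "finite F" unfolding F_def using finite_subset[OF _ T(1)] by (auto intro!: finite_PiE)
  let ?C = "topspace (full_shift F) :: ('g \<Rightarrow> nat \<Rightarrow> 'k) set"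
  define R where "R z = (\<lambda>g. restrict (\<lambda>i. \<rho> (z g i)) {..<d})" for z :: "'g \<Rightarrow> nat \<Rightarrow> 'k"
  define val where "val z \<longleftrightarrow> (\<forall>g. \<forall>i<d. z g i \<in> A)" for z :: "'g \<Rightarrow> nat \<Rightarrow> 'k"
  define eqv where "eqv z w \<longleftrightarrow> (\<forall>g. \<forall>i<d. z g i - w g i \<in> I)" for z w :: "'g \<Rightarrow> nat \<Rightarrow> 'k"
  have RC: "R z \<in> ?C" if "val z" for z
    using that by (auto simp: topspace_full_shift R_def F_def val_def)
  have valC: "val x" if "x \<in> ?C" for x
  proof -
    have "x g i \<in> \<rho> ` A" if "i < d" for g i
      using \<open>x \<in> ?C\<close> that by (auto simp: topspace_full_shift F_def PiE_iff)
    moreover have "\<rho> ` A \<subseteq> A" using \<rho>A by (rule image_subsetI)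
    ultimately have "x g i \<in> A" if "i < d" for g i using that by (simp add: subset_iff)
    then show ?thesis by (simp add: val_def)
  qed
  have Rid: "R x = x" if "x \<in> ?C" for x
  proof (intro ext)
    fix g i
    have *: "x g \<in> PiE {..<d} (\<lambda>_. \<rho> ` A)" using that by (simp add: topspace_full_shift F_def)
    show "R x g i = x g i"
    proof (cases "i < d")
      case True
      then have "x g i \<in> \<rho> ` A" using * by (auto simp: PiE_iff)
      then show ?thesis using True \<rho>\<rho> by (auto simp: R_def)
    next
      case False
      then show ?thesis using PiE_arb[OF *] by (simp add: R_def)
    qed
  qed
  have R_eqv: "eqv z (R z)" if "val z" for z
    using that \<rho>(2) by (auto simp: eqv_def R_def val_def)
  have R_cong: "R z = R w" if "eqv z w" for z w
  proof
    fix g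
    show "R z g = R w g" unfolding R_def using that \<rho>_cong by (intro restrict_ext) (simp add: eqv_def)
  qed
  have R_eqD: "eqv z w" if "R z = R w" "val z" "val w" for z w
    unfolding eqv_def
  proof (intro allI impI)
    fix g i assume "i < d"
    then have "\<rho> (z g i) = \<rho> (w g i)"
      using fun_cong[OF fun_cong[OF that(1), of g], of i] by (simp add: R_def)
    then show "z g i - w g i \<in> I" using \<rho>_eqD that \<open>i < d\<close> by (simp add: val_def)
  qed
  have eqv_trans: "eqv x z" if "eqv x y" "eqv y z" for x y z
    using that i(3) unfolding eqv_def by (metis diff_add_cancel add_diff_eq)
  have eqv_sym: "eqv y x" if "eqv x y" for x y
    using that i(6) unfolding eqv_def by (metis minus_diff_eq)
  have val_act: "val (mat_act M x)" if "M \<in> carrier_mat d d" "coeffs_in A M" "val x" for M x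
    using that mat_act_in[OF A that(1,2)] by (simp add: val_def)
  have eqv_act: "eqv (mat_act M x) (mat_act M y)" if "M \<in> carrier_mat d d" "coeffs_in A M" "eqv x y" for M x y
    using that mat_act_cong_mod[OF A I that(1,2)] by (simp add: eqv_def)
  define \<tau> where "\<tau> M x = R (mat_act M x)" for M x
  have \<tau>C: "\<tau> M x \<in> ?C" if "M \<in> carrier_mat d d" "coeffs_in A M" "x \<in> ?C" for M x
    unfolding \<tau>_def by (intro RC val_act valC that)
  have \<tau>\<tau>: "\<tau> M (\<tau> N x) = R (mat_act M (mat_act N x))"
    if "M \<in> carrier_mat d d" "coeffs_in A M" "N \<in> carrier_mat d d" "coeffs_in A N" "x \<in> ?C" for M N x
    unfolding \<tau>_def by (intro R_cong eqv_act eqv_sym[OF R_eqv] val_act valC that)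
  have ca: "cellular_automaton F (\<tau> Y)"
    unfolding cellular_automaton_def
  proof (intro conjI allI ballI)
    have "continuous_map (full_shift F) (discrete_topology F) (\<lambda>x. \<tau> Y x g)" for g
    proof (rule continuous_map_local_rule)
      let ?D = "(\<lambda>h. g + h) ` (\<Union>i<d. \<Union>j<d. Poly_Mapping.keys (Y $$ (i, j)))"
      show "finite ?D" by auto
      show "\<tau> Y x g \<in> F" if "x \<in> ?C" for x
        using \<tau>C[OF Y that] by (simp add: topspace_full_shift)
      show "\<tau> Y x g = \<tau> Y y g" if "\<And>h. h \<in> ?D \<Longrightarrow> x h = y h" for x y
      proof -
        have "mat_act Y x g i = mat_act Y y g i" if "i < d" for i
          unfolding mat_act_def act_def
        proof (intro sum.cong refl)
          fix j h assume "j \<in> {..<dim_col Y}" "h \<in> Poly_Mapping.keys (Y $$ (i, j))"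
          then have "x (g + h) = y (g + h)"
            using Y(1) that by (intro \<open>\<And>h. h \<in> ?D \<Longrightarrow> x h = y h\<close>) auto
          then show "Poly_Mapping.lookup (Y $$ (i, j)) h * x (g + h) j
            = Poly_Mapping.lookup (Y $$ (i, j)) h * y (g + h) j" by simp
        qed
        then show ?thesis unfolding \<tau>_def R_def by (intro restrict_ext) simp
      qed
    qed
    then show "continuous_map (full_shift F) (full_shift F) (\<tau> Y)"
      unfolding full_shift_def[where F = F] continuous_map_componentwise_UNIV by simp
    fix \<gamma> and x :: "'g \<Rightarrow> nat \<Rightarrow> 'k"
    have "mat_act Y (shift \<gamma> x) g i = mat_act Y x (- \<gamma> + g) i" for g i
      unfolding mat_act_def shift_def by (simp add: act_shift[of _ "\<lambda>h. x h _"])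
    then show "\<tau> Y (shift \<gamma> x) = shift \<gamma> (\<tau> Y x)"
      by (simp add: \<tau>_def R_def fun_eq_iff) (simp add: shift_def)
  qed
  have XYid: "\<tau> X (\<tau> Y x) = x" if x: "x \<in> ?C" for x
  proof -
    have "mat_act X (mat_act Y x) g i = x g i" if "i < d" for g i
      using mat_act_mult[OF X(1) Y(1) that, of x g] mat_act_one[OF that, of x g] XY by simp
    then have "eqv (mat_act X (mat_act Y x)) x" using i(1) by (simp add: eqv_def)
    then show ?thesis using \<tau>\<tau>[OF X Y x] R_cong Rid[OF x] by metis
  qed
  have "inj_on (\<tau> Y) ?C" by (rule inj_on_inverseI[of _ "\<tau> X"]) (rule XYid)
  then have onto: "\<tau> Y ` ?C = ?C" by (rule surjunctive_alphabet[OF surj \<open>finite F\<close> ca])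
  have YX: "eqv (mat_act Y (mat_act X x)) x" if x: "x \<in> ?C" for x
  proof -
    obtain w where w: "w \<in> ?C" "x = \<tau> Y w" using onto x by blast
    have "\<tau> Y (\<tau> X x) = x" unfolding w(2) XYid[OF w(1)] ..
    then have "R (mat_act Y (mat_act X x)) = R x" using \<tau>\<tau>[OF Y X x] Rid[OF x] by simp
    then show ?thesis by (rule R_eqD) (intro val_act Y X valC x)+
  qed
  \<comment> \<open>The point configuration need not consist of chosen representatives; \<open>R \<delta>\<close> does.\<close>
  define \<delta> :: "'g \<Rightarrow> nat \<Rightarrow> 'k" where "\<delta> = (\<lambda>g k. if g = h \<and> k = j then 1 else 0)"
  have "val \<delta>" using unital_subringD(1,2)[OF A] by (simp add: val_def \<delta>_def)
  then have \<delta>: "eqv \<delta> (R \<delta>)" "R \<delta> \<in> ?C" by (auto intro: R_eqv RC)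
  have "eqv (mat_act Y (mat_act X \<delta>)) \<delta>"
    by (rule eqv_trans[OF eqv_act[OF Y eqv_act[OF X \<delta>(1)]] eqv_trans[OF YX[OF \<delta>(2)] eqv_sym[OF \<delta>(1)]]])
  then have "mat_act Y (mat_act X \<delta>) 0 i - \<delta> 0 i \<in> I" using ij by (simp add: eqv_def)
  moreover have "mat_act Y (mat_act X \<delta>) 0 i = Poly_Mapping.lookup ((Y * X) $$ (i, j)) h"
    using mat_act_mult[OF Y(1) X(1) ij(1), of \<delta> 0] mat_act_delta[of "Y * X" d i j h] X Y ij
    by (simp add: \<delta>_def)
  moreover have "\<delta> 0 i = Poly_Mapping.lookup (1\<^sub>m d $$ (i, j)) h"
    using mat_act_one[OF ij(1), of \<delta> 0] mat_act_delta[OF one_carrier_mat ij, of h]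
    unfolding \<delta>_def by (rule trans[OF sym])
  ultimately show ?thesis by simp
qed

section \<open>Stable finiteness\<close>

theorem corollary1p9:
  assumes "surjunctive TYPE('g::group_add)"
  shows "stably_finite TYPE('g \<Rightarrow>\<^sub>0 'k::field)"
  unfolding stably_finite_def directly_finite_def
proof (intro allI impI ballI)
  fix d :: nat and X Y :: "('g \<Rightarrow>\<^sub>0 'k) mat"
  let ?R = "ring_mat TYPE('g \<Rightarrow>\<^sub>0 'k) d ()"
  assume "X \<in> carrier ?R" "Y \<in> carrier ?R" "X \<otimes>\<^bsub>?R\<^esub> Y = \<one>\<^bsub>?R\<^esub>"
  then have X: "X \<in> carrier_mat d d" and Y: "Y \<in> carrier_mat d d" and XY: "X * Y = 1\<^sub>m d"
    by (simp_all add: ring_mat_simps)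
  have "Y * X = 1\<^sub>m d"
  proof (rule ccontr)
    assume "Y * X \<noteq> 1\<^sub>m d"
    then obtain i j where ij: "i < d" "j < d" "(Y * X) $$ (i, j) \<noteq> 1\<^sub>m d $$ (i, j)"
      using X Y by (auto simp: mat_eq_iff)
    then obtain h where h: "Poly_Mapping.lookup ((Y * X) $$ (i, j)) h \<noteq> Poly_Mapping.lookup (1\<^sub>m d $$ (i, j)) h"
      by (meson poly_mapping_eqI)
    define c where "c = Poly_Mapping.lookup ((Y * X) $$ (i, j)) h - Poly_Mapping.lookup (1\<^sub>m d $$ (i, j)) h"
    define E where "E M = (\<Union>i<d. \<Union>j<d. Poly_Mapping.lookup (M $$ (i, j)) ` Poly_Mapping.keys (M $$ (i, j)))"
      for M :: "('g \<Rightarrow>\<^sub>0 'k) mat"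
    have "finite (insert c (E X \<union> E Y))" by (auto simp: E_def)
    then obtain A where A: "unital_subring A" "insert c (E X \<union> E Y) \<subseteq> A" "separated_by_finite_primes A"
      using separated_subring_containing by blast
    have E: "coeffs_in A M" if "E M \<subseteq> A" "M \<in> carrier_mat d d" for M
      unfolding coeffs_in_def
    proof (intro allI impI)
      fix i j h assume "i < dim_row M" "j < dim_col M"
      then show "Poly_Mapping.lookup (M $$ (i, j)) h \<in> A"
        using that unital_subringD(2)[OF A(1)]
        by (cases "h \<in> Poly_Mapping.keys (M $$ (i, j))") (force simp: E_def in_keys_iff)+
    qed
    obtain P where P: "prime_ideal_of A P" "finite_index A P" "c \<notin> P"
      using A(2,3) h by (auto simp: separated_by_finite_primes_def c_def)
    have "c \<in> P"
      unfolding c_def using P(1) A(2) X Y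
      by (intro surjunctive_left_inverse_mod_ideal[OF assms A(1) _ P(2) X _ Y _ XY ij(1,2)] E)
        (auto simp: prime_ideal_of_def)
    then show False using P(3) by blast
  qed
  then show "Y \<otimes>\<^bsub>?R\<^esub> X = \<one>\<^bsub>?R\<^esub>" by (simp add: ring_mat_simps)
qed

end
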